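(* For every integer $k$ with $2\leq k<\infty$, the graph property "$G$ contains $k$ independent edges" (that is, $G$ contains $k$ pairwise disjoint edges), for graphs $G$ on the vertex set $\mathbb{N}$, is not $\infty$-elusive.
   Context: Let $[\mathbb{N}]^2=\{\{n,k\}: n,k\in\mathbb{N},\ n\neq k\}$. A graph on $\mathbb{N}$ is a subset $G\subseteq[\mathbb{N}]^2$, so the set of graphs is $2^{[\mathbb{N}]^2}$. A graph property is an isomorphism-invariant subset $\mathcal{S}\subseteq 2^{[\mathbb{N}]^2}$. The game $G(\mathcal{S})$. Two players, Seeker and Hider, colour the edges of the complete graph on $\mathbb{N}$ with red, white, green. Initially all edges are white. In each turn Seeker picks a white edge and Hider recolours it green or red. The game terminates after infinitely many (that is, $\omega$ many) turns. Let $R_\infty,W_\infty,G_\infty$ be the sets of red, white and green edges at the end, and let $\mathcal{P}_\infty=\{G\subseteq[\mathbb{N}]^2: G_\infty\subseteq G\subseteq G_\infty\cup W_\infty\}$. Seeker wins if and only if $W_\infty\neq\emptyset$ and either $\mathcal{P}_\infty\subseteq\mathcal{S}$ or $\mathcal{P}_\infty\subseteq 2^{[\mathbb{N}]^2}\setminus\mathcal{S}$; otherwise Hider wins. The property $\mathcal{S}$ is $\infty$-elusive if Seeker does not have a winning strategy in $G(\mathcal{S})$; thus "not $\infty$-elusive" means that Seeker has a winning strategy in $G(\mathcal{S})$. *)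

theory Defs
  imports Main
begin

type_synonym edge = "nat set"
type_synonym graph = "edge set"

definition edges :: "edge set" where
  "edges = {{n, k} | n k. n \<noteq> k}"

definition graph_property :: "graph set \<Rightarrow> bool" where
  "graph_property S \<longleftrightarrow> S \<subseteq> Pow edges \<and>
     (\<forall>G H \<pi>. G \<in> S \<and> bij \<pi> \<and> H = (\<lambda>e. \<pi> ` e) ` G \<longrightarrow> H \<in> S)"

text \<open>
  White is not a colour that Hider can choose: an edge is white as long as
  Seeker has not picked it. A turn is the edge picked by Seeker together with
  the colour given to it by Hider.
\<close>

datatype colour = Red | Green

type_synonym turn = "edge \<times> colour"
type_synonym play = "nat \<Rightarrow> turn"

definition legal :: "play \<Rightarrow> bool" where
  "legal p \<longleftrightarrow> (\<forall>n. fst (p n) \<in> edges \<and> (\<forall>i<n. fst (p n) \<noteq> fst (p i)))"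

definition red_edges :: "play \<Rightarrow> edge set" where
  "red_edges p = {e. \<exists>n. p n = (e, Red)}"

definition green_edges :: "play \<Rightarrow> edge set" where
  "green_edges p = {e. \<exists>n. p n = (e, Green)}"

definition white_edges :: "play \<Rightarrow> edge set" where
  "white_edges p = edges - (red_edges p \<union> green_edges p)"

definition possible_graphs :: "play \<Rightarrow> graph set" where
  "possible_graphs p =
     {G. G \<subseteq> edges \<and> green_edges p \<subseteq> G \<and> G \<subseteq> green_edges p \<union> white_edges p}"

definition seeker_wins :: "graph set \<Rightarrow> play \<Rightarrow> bool" where
  "seeker_wins S p \<longleftrightarrow> white_edges p \<noteq> {} \<and>
     (possible_graphs p \<subseteq> S \<or> possible_graphs p \<subseteq> Pow edges - S)"

text \<open>
  A strategy of Seeker maps the finite history of turns made so far, in order,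
  to the next edge. In \<open>follows \<sigma> p\<close> the colours in \<open>p\<close> are unconstrained, so
  the plays following \<open>\<sigma>\<close> correspond exactly to the sequences of colours chosen
  by Hider. Legality is demanded in the definition of a winning strategy, not
  assumed there: Seeker must never pick an edge that is no longer white.
\<close>

type_synonym strategy = "turn list \<Rightarrow> edge"

definition follows :: "strategy \<Rightarrow> play \<Rightarrow> bool" where
  "follows \<sigma> p \<longleftrightarrow> (\<forall>n. fst (p n) = \<sigma> (map p [0..<n]))"

definition winning_strategy :: "graph set \<Rightarrow> strategy \<Rightarrow> bool" where
  "winning_strategy S \<sigma> \<longleftrightarrow> (\<forall>p. follows \<sigma> p \<longrightarrow> legal p \<and> seeker_wins S p)"

definition infinity_elusive :: "graph set \<Rightarrow> bool" where
  "infinity_elusive S \<longleftrightarrow> \<not> (\<exists>\<sigma>. winning_strategy S \<sigma>)"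

definition contains_independent_edges :: "nat \<Rightarrow> graph set" where
  "contains_independent_edges k =
     {G. G \<subseteq> edges \<and> (\<exists>M. M \<subseteq> G \<and> finite M \<and> card M = k \<and> pairwise disjnt M)}"

lemma graph_property_contains_independent_edges:
  "graph_property (contains_independent_edges k)"
proof -
  have "(\<lambda>e. \<pi> ` e) ` G \<in> contains_independent_edges k"
    if G: "G \<in> contains_independent_edges k" and \<pi>: "bij \<pi>" for G \<pi>
  proof -
    from G obtain M where M: "M \<subseteq> G" "finite M" "card M = k" "pairwise disjnt M"
      and GE: "G \<subseteq> edges"
      by (auto simp: contains_independent_edges_def)
    have inj: "inj \<pi>" using \<pi> by (rule bij_is_inj)
    have "\<pi> ` e \<in> edges" if "e \<in> edges" for e
    proof -
      from that obtain a b where "e = {a, b}" "a \<noteq> b" by (auto simp: edges_def)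
      then have "\<pi> ` e = {\<pi> a, \<pi> b}" "\<pi> a \<noteq> \<pi> b" using inj by (auto simp: inj_def)
      then show ?thesis by (auto simp: edges_def)
    qed
    then have E: "(\<lambda>e. \<pi> ` e) ` G \<subseteq> edges" using GE by blast
    have "inj_on (\<lambda>e. \<pi> ` e) M" using inj by (auto simp: inj_on_def inj_image_eq_iff)
    then have "card ((\<lambda>e. \<pi> ` e) ` M) = k" using M(3) by (simp add: card_image)
    moreover have "pairwise disjnt ((\<lambda>e. \<pi> ` e) ` M)"
      using M(4) inj by (fastforce simp: pairwise_def disjnt_def inj_def)
    moreover have "(\<lambda>e. \<pi> ` e) ` M \<subseteq> (\<lambda>e. \<pi> ` e) ` G" using M(1) by blast
    ultimately show ?thesis
      using E M(2) unfolding contains_independent_edges_def by blast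
  qed
  then show ?thesis
    by (auto simp: graph_property_def contains_independent_edges_def)
qed

end

theory Submission
  imports Defs "HOL-Library.Nat_Bijection"
begin

text \<open>
  Write \<open>k = n + 1\<close> with \<open>n \<ge> 1\<close>. Seeker always holds one white edge \<open>e\<close> in reserve and asks the
  other edges one after the other. The reserve may be replaced when Hider answers green, but if
  it is constant from some turn on, then \<open>e\<close> is the only edge that stays white. Hence Seeker wins as
  soon as \<open>e\<close> is harmless at every late turn: the graph \<open>H\<close> of green edges has an
  \<open>(n+1)\<close>-matching already, or \<open>H + e\<close> has none either. Matchings are finite, so this passes to
  the final green graph.

  The difficulty is that a harmless white edge must exist after every green answer. Call a
  graph critical if it has no \<open>(n+1)\<close>-matching but every vertex is avoided by some
  \<open>n\<close>-matching; these are the graphs whose components are all factor-critical, in which the only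
  harmless edges are those inside a component. If \<open>H\<close> is not critical and has no
  \<open>(n+1)\<close>-matching, then some vertex \<open>v\<close> is met by all \<open>n\<close>-matchings, and every edge at \<open>v\<close> is
  harmless; infinitely many of them are white. The danger is that a green answer makes \<open>H\<close>
  critical when all components are already filled with red and green edges. For \<open>k = 2\<close> this is a green
  triangle. Seeker avoids it by holding back an edge \<open>f\<close> for which \<open>H + f\<close> is critical, whenever
  there is a white one. This works because of \<open>critical_insert_insert\<close>: if \<open>H + f\<close> and
  \<open>H + g\<close> are both critical, then so is \<open>H + f + g\<close>. So after a green answer \<open>g\<close> either \<open>H + g\<close>
  is not critical and a fresh choice is possible, or \<open>f\<close> can be kept. The empty graph is not
  critical because \<open>n \<ge> 1\<close>, so Seeker can start. The lemma rests on Gallai's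
  lemma (\<open>gallai_lemma\<close>), that in a critical graph no \<open>n\<close>-matching avoids two vertices of one
  component, and on the exchange argument \<open>matching_exchange\<close> behind it.

  It remains to see that the reserve changes only finitely often. It does not change at a red answer.
  If some vertex \<open>b\<close> has green degree above \<open>2n\<close>, then edges at \<open>b\<close> are harmless forever, and
  Seeker holds one of them until the end. Otherwise an infinite green graph would contain matchings of every
  size (\<open>infinite_matching_or_hub\<close>), so if no \<open>(n+1)\<close>-matching turns green, Hider answers green only
  finitely often.
\<close>

section \<open>Matchings that avoid given vertices\<close>

text \<open>
  The set of vertices to be avoided is a parameter because the statement that no maximum matching avoids two given
  vertices says exactly that joining them by an edge does not enlarge the matching number.
\<close>

definition matching_avoiding :: "nat \<Rightarrow> graph \<Rightarrow> nat set \<Rightarrow> bool" where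
  "matching_avoiding n E S \<longleftrightarrow>
     (\<exists>M. M \<subseteq> E \<and> finite M \<and> card M = n \<and> pairwise disjnt M \<and> \<Union>M \<inter> S = {})"

lemma matching_avoidingI:
  "M \<subseteq> E \<Longrightarrow> finite M \<Longrightarrow> card M = n \<Longrightarrow> pairwise disjnt M \<Longrightarrow> \<Union>M \<inter> S = {} \<Longrightarrow>
   matching_avoiding n E S"
  unfolding matching_avoiding_def by blast

lemma matching_avoidingE:
  assumes "matching_avoiding n E S"
  obtains M where "M \<subseteq> E" "finite M" "card M = n" "pairwise disjnt M" "\<Union>M \<inter> S = {}"
  using assms unfolding matching_avoiding_def by auto

lemma contains_independent_edges_iff:
  "G \<in> contains_independent_edges k \<longleftrightarrow> G \<subseteq> edges \<and> matching_avoiding k G {}"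
  by (auto simp: contains_independent_edges_def matching_avoiding_def)

lemma edgesE:
  assumes "e \<in> edges" obtains a b where "e = {a, b}" "a \<noteq> b"
  using assms by (auto simp: edges_def)

lemma edges_other_end:
  assumes "e \<in> edges" "a \<in> e" obtains b where "e = {a, b}" "a \<noteq> b"
  using assms by (auto simp: edges_def)

lemma doubleton_in_edges [simp]: "{a, b} \<in> edges \<longleftrightarrow> a \<noteq> b"
  by (auto simp: edges_def doubleton_eq_iff)

lemma finite_edge: "e \<in> edges \<Longrightarrow> finite e"
  by (auto simp: edges_def)

lemma matching_avoiding_mono:
  "matching_avoiding n E S \<Longrightarrow> E \<subseteq> E' \<Longrightarrow> S' \<subseteq> S \<Longrightarrow> matching_avoiding n E' S'"
  by (elim matching_avoidingE, rule matching_avoidingI) auto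

text \<open>A matching that avoids an end of \<open>f\<close> cannot use \<open>f\<close>.\<close>

lemma matching_avoiding_insert_meeting:
  assumes "matching_avoiding n (insert f E) S" "f \<inter> S \<noteq> {}"
  shows "matching_avoiding n E S"
proof -
  obtain M where M: "M \<subseteq> insert f E" "finite M" "card M = n" "pairwise disjnt M" "\<Union>M \<inter> S = {}"
    using assms(1) by (rule matching_avoidingE)
  then have "f \<notin> M" using assms(2) by blast
  then show ?thesis using M by (intro matching_avoidingI[of M]) auto
qed

lemma matching_avoiding_add_edge:
  assumes "matching_avoiding n E (f \<union> S)" "f \<inter> S = {}" "f \<noteq> {}"
  shows "matching_avoiding (Suc n) (insert f E) S"
proof -
  obtain M where M: "M \<subseteq> E" "finite M" "card M = n" "pairwise disjnt M" "\<Union>M \<inter> (f \<union> S) = {}"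
    using assms(1) by (rule matching_avoidingE)
  have "f \<notin> M" using M(5) assms(3) by blast
  moreover have "pairwise disjnt (insert f M)"
    using M(4,5) by (auto simp: pairwise_insert disjnt_def)
  ultimately show ?thesis
    unfolding matching_avoiding_def
    by (intro exI[of _ "insert f M"]) (use M assms(2) in auto)
qed

lemma matching_avoiding_remove_edge:
  assumes "M \<subseteq> E" "finite M" "card M = Suc n" "pairwise disjnt M" "\<Union>M \<inter> S = {}" "f \<in> M"
  shows "matching_avoiding n {e \<in> E. e \<inter> f = {}} (f \<union> S)"
proof -
  have disj: "e \<inter> f = {}" if "e \<in> M - {f}" for e
    using that assms(4,6) by (auto simp: pairwise_def disjnt_def)
  show ?thesis
  proof (rule matching_avoidingI)
    show "pairwise disjnt (M - {f})" using assms(4) by (auto simp: pairwise_def)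
    show "M - {f} \<subseteq> {e \<in> E. e \<inter> f = {}}" using assms(1) disj by blast
    show "finite (M - {f})" "card (M - {f}) = n" using assms(2,3,6) by simp_all
    have "\<Union>(M - {f}) \<inter> f = {}" using disj by (simp add: Int_Union2)
    moreover have "\<Union>(M - {f}) \<inter> S = {}" using assms(5) by blast
    ultimately show "\<Union>(M - {f}) \<inter> (f \<union> S) = {}" by (simp add: Int_Un_distrib)
  qed
qed

lemma matching_avoiding_ends_of_new_edge:
  assumes "matching_avoiding (Suc n) (insert f E) {}" "\<not> matching_avoiding (Suc n) E {}"
  shows "matching_avoiding n E f"
proof -
  obtain M where M: "M \<subseteq> insert f E" "finite M" "card M = Suc n" "pairwise disjnt M" "\<Union>M \<inter> {} = {}"
    using assms(1) by (rule matching_avoidingE)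
  have f: "f \<in> M" using M assms(2) matching_avoidingI[of M E "Suc n" "{}"] by auto
  have disj: "e \<inter> f = {}" if "e \<in> M - {f}" for e
    using that M(4) f by (auto simp: pairwise_def disjnt_def)
  show ?thesis
  proof (rule matching_avoidingI)
    show "pairwise disjnt (M - {f})" using M(4) by (auto simp: pairwise_def)
    show "M - {f} \<subseteq> E" using M(1) by blast
    show "finite (M - {f})" "card (M - {f}) = n" using M(2,3) f by simp_all
    show "\<Union>(M - {f}) \<inter> f = {}" using disj by (simp add: Int_Union2)
  qed
qed

section \<open>Exchange along alternating paths\<close>

abbreviation reachable :: "graph \<Rightarrow> nat \<Rightarrow> nat \<Rightarrow> bool" where
  "reachable E u v \<equiv> (u, v) \<in> {(a, b). {a, b} \<in> E}\<^sup>*"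

text \<open>
  Let \<open>N\<close> avoid \<open>S\<close> and \<open>N'\<close> avoid \<open>v\<close>. The alternating path of \<open>N \<union> N'\<close> that starts at \<open>v\<close>
  has even length, since otherwise it would augment \<open>N'\<close>. Switching \<open>N\<close> along the path frees
  \<open>v\<close> and covers only the other end \<open>z\<close>, which costs at most one vertex of \<open>S\<close>. The induction walks
  this path two edges at a time, so that no paths or symmetric differences have to be handled.
\<close>

lemma matching_exchange:
  assumes "E \<subseteq> edges" "\<not> matching_avoiding (Suc n) E {}"
    and "matching_avoiding n E {v}" "matching_avoiding n E S"
  shows "matching_avoiding n E (insert v S) \<or>
    (\<exists>z\<in>S. reachable E v z \<and> matching_avoiding n E (insert v (S - {z})))"
  using assms
proof (induction n arbitrary: E v)
  case 0
  then show ?case by (auto simp: matching_avoiding_def)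
next
  case (Suc n)
  obtain N where N: "N \<subseteq> E" "finite N" "card N = Suc n" "pairwise disjnt N" "\<Union>N \<inter> S = {}"
    using Suc.prems(4) by (rule matching_avoidingE)
  obtain N' where N': "N' \<subseteq> E" "finite N'" "card N' = Suc n" "pairwise disjnt N'" "\<Union>N' \<inter> {v} = {}"
    using Suc.prems(3) by (rule matching_avoidingE)
  show ?case
  proof (cases "v \<in> \<Union>N")
    case False
    then have "\<Union>N \<inter> insert v S = {}" using N(5) by blast
    then show ?thesis using N matching_avoidingI[of N E "Suc n" "insert v S"] by simp
  next
    case True
    then obtain x where x: "{v, x} \<in> N" "v \<noteq> x"
      using N(1) Suc.prems(1) by (metis UnionE edges_other_end in_mono)
    have vxE: "insert {v, x} E = E" using x N(1) by auto
    have xS: "v \<notin> S" "x \<notin> S" using x N(5) by auto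
    have "x \<in> \<Union>N'"
    proof (rule ccontr)
      assume "x \<notin> \<Union>N'"
      then have "matching_avoiding (Suc n) E ({v, x} \<union> {})"
        using N' by (intro matching_avoidingI[of N']) auto
      then have "matching_avoiding (Suc (Suc n)) (insert {v, x} E) {}"
        by (rule matching_avoiding_add_edge) auto
      then show False using Suc.prems(2) vxE by simp
    qed
    then obtain y where y: "{x, y} \<in> N'" "x \<noteq> y"
      using N'(1) Suc.prems(1) by (metis UnionE edges_other_end in_mono)
    have yv: "y \<noteq> v" using y N'(5) by auto
    have xyE: "insert {x, y} E = E" using y N'(1) by auto
    have vx: "reachable E v x" using x N(1) by auto
    have xy: "(x, y) \<in> {(a, b). {a, b} \<in> E}" using y N'(1) by auto
    have vy: "reachable E v y" using vx xy by (rule rtrancl.rtrancl_into_rtrancl)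
    \<comment> \<open>Delete the first two vertices \<open>v\<close>, \<open>x\<close> of the alternating path and continue from \<open>y\<close>.\<close>
    define E' where "E' = {e \<in> E. e \<inter> {v, x} = {}}"
    have E'E: "E' \<subseteq> E" by (auto simp: E'_def)
    have extend: "matching_avoiding (Suc n) E (insert v T)"
      if "matching_avoiding n E' (insert y T)" "x \<notin> T" "y \<notin> T" for T
    proof -
      obtain M where M: "M \<subseteq> E'" "finite M" "card M = n" "pairwise disjnt M" "\<Union>M \<inter> insert y T = {}"
        using \<open>matching_avoiding n E' (insert y T)\<close> by (rule matching_avoidingE)
      have "v \<notin> \<Union>M" "x \<notin> \<Union>M" using M(1) by (auto simp: E'_def)
      then have "\<Union>M \<inter> ({x, y} \<union> insert v T) = {}" using M(5) by auto
      then have "matching_avoiding n E ({x, y} \<union> insert v T)"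
        using M E'E by (intro matching_avoidingI[of M]) auto
      then have "matching_avoiding (Suc n) (insert {x, y} E) (insert v T)"
        by (rule matching_avoiding_add_edge) (use that yv x(2) in auto)
      then show ?thesis using xyE by simp
    qed
    have NS: "matching_avoiding n E' ({v, x} \<union> S)"
      unfolding E'_def using N x by (intro matching_avoiding_remove_edge[where M = N]) auto
    have N'y: "matching_avoiding n E' {y}"
    proof -
      have "matching_avoiding n {e \<in> E. e \<inter> {x, y} = {}} ({x, y} \<union> {v})"
        using N' y by (intro matching_avoiding_remove_edge[where M = N']) auto
      then obtain M where "M \<subseteq> {e \<in> E. e \<inter> {x, y} = {}}" "finite M" "card M = n"
        "pairwise disjnt M" "\<Union>M \<inter> ({x, y} \<union> {v}) = {}"
        by (rule matching_avoidingE)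
      then show ?thesis
        by (intro matching_avoidingI[of M]) (auto simp: E'_def)
    qed
    have max': "\<not> matching_avoiding (Suc n) E' {}"
    proof
      assume "matching_avoiding (Suc n) E' {}"
      then have "matching_avoiding (Suc n) E ({v, x} \<union> {})"
        by (elim matching_avoidingE, intro matching_avoidingI) (auto simp: E'_def)
      then have "matching_avoiding (Suc (Suc n)) (insert {v, x} E) {}"
        by (rule matching_avoiding_add_edge) auto
      then show False using Suc.prems(2) vxE by simp
    qed
    show ?thesis
    proof (cases "y \<in> S")
      case True
      have "matching_avoiding n E' (insert y (S - {y}))"
        using NS by (rule matching_avoiding_mono) (use True in auto)
      then have "matching_avoiding (Suc n) E (insert v (S - {y}))"
        by (rule extend) (use xS in auto)
      then show ?thesis using True vy by blast
    next
      case False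
      have "matching_avoiding n E' S" using NS by (rule matching_avoiding_mono) auto
      from Suc.IH[OF _ max' N'y this] E'E Suc.prems(1)
      consider "matching_avoiding n E' (insert y S)"
        | z where "z \<in> S" "reachable E' y z" "matching_avoiding n E' (insert y (S - {z}))"
        by blast
      then show ?thesis
      proof cases
        case 1
        then show ?thesis using extend[OF 1] xS False by simp
      next
        case 2
        have "{(a, b). {a, b} \<in> E'} \<subseteq> {(a, b). {a, b} \<in> E}" using E'E by auto
        from subsetD[OF rtrancl_mono[OF this] 2(2)] have "reachable E y z" .
        with vy have "reachable E v z" by (rule rtrancl_trans)
        moreover have "matching_avoiding (Suc n) E (insert v (S - {z}))"
          using 2(3) by (rule extend) (use xS False in auto)
        ultimately show ?thesis using 2(1) by blast
      qed
    qed
  qed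
qed

section \<open>Critical graphs\<close>

text \<open>
  The vertex \<open>v\<close> ranges over all of \<open>\<nat>\<close>, not only over the vertices met by \<open>E\<close>. With the isolated
  vertices as components of size one, these are the graphs with \<open>n\<close> as matching number in
  which every component is factor-critical.
\<close>

definition critical :: "nat \<Rightarrow> graph \<Rightarrow> bool" where
  "critical n E \<longleftrightarrow> \<not> matching_avoiding (Suc n) E {} \<and> (\<forall>v. matching_avoiding n E {v})"

lemma critical_imp_no_matching: "critical n E \<Longrightarrow> \<not> matching_avoiding (Suc n) E {}"
  by (simp add: critical_def)

lemma no_matching_avoiding_edge:
  assumes "\<not> matching_avoiding (Suc n) E {}" "{u, v} \<in> E"
  shows "\<not> matching_avoiding n E {u, v}"
proof
  assume "matching_avoiding n E {u, v}"
  then have "matching_avoiding (Suc n) (insert {u, v} E) {}"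
    by (intro matching_avoiding_add_edge) auto
  then show False using assms by (simp add: insert_absorb)
qed

text \<open>
  Not being avoidable together is transitive: if an \<open>n\<close>-matching avoids \<open>u\<close> and \<open>v\<close>,
  then exchanging at a third vertex \<open>v'\<close>, which criticality permits, gives one that avoids
  \<open>v'\<close> and one of \<open>u\<close>, \<open>v\<close>. Adjacent vertices are not avoidable together, and the
  claim follows along a path.
\<close>

lemma gallai_lemma:
  assumes "E \<subseteq> edges" "critical n E" "reachable E u v" "u \<noteq> v"
  shows "\<not> matching_avoiding n E {u, v}"
  using assms(3,4)
proof (induction rule: rtrancl_induct)
  case base
  then show ?case by simp
next
  case (step v' v)
  have edge: "{v', v} \<in> E" using step.hyps(2) by simp
  note max = critical_imp_no_matching[OF assms(2)]
  show ?case
  proof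
    assume uv: "matching_avoiding n E {u, v}"
    show False
    proof (cases "u = v'")
      case True
      then show False using no_matching_avoiding_edge[OF max edge] uv by simp
    next
      case False
      have IH: "\<not> matching_avoiding n E {u, v'}" using step.IH False by simp
      have edge': "\<not> matching_avoiding n E {v', v}" by (rule no_matching_avoiding_edge[OF max edge])
      have "matching_avoiding n E {v'}" using assms(2) by (simp add: critical_def)
      from matching_exchange[OF assms(1) max this uv]
      have "\<exists>S. matching_avoiding n E S \<and> ({u, v'} \<subseteq> S \<or> {v', v} \<subseteq> S)"
        using step.prems by blast
      then show False using IH edge' matching_avoiding_mono by blast
    qed
  qed
qed

text \<open>
  An \<open>(n+1)\<close>-matching of \<open>H + f + g\<close> would leave an \<open>n\<close>-matching of \<open>H + f\<close> that avoids
  both ends of \<open>g\<close>. Whenever an \<open>n\<close>-matching of \<open>H + f\<close> avoids an end \<open>p\<close> of \<open>f\<close>, it lies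
  in \<open>H\<close> and hence in \<open>H + g\<close>, and likewise with \<open>f\<close> and \<open>g\<close> interchanged. Exchanging at \<open>p\<close>
  in \<open>H + f\<close> and then at an end \<open>x\<close> of \<open>g\<close> in \<open>H + g\<close> moves matchings between the two graphs
  until they contradict Gallai's lemma for \<open>p\<close> and \<open>x\<close> in \<open>H + f\<close>.
\<close>

lemma critical_insert_insert:
  assumes HE: "H \<subseteq> edges" and f: "f \<in> edges" and g: "g \<in> edges"
    and cf: "critical n (insert f H)" and cg: "critical n (insert g H)"
  shows "critical n (insert g (insert f H))"
proof -
  obtain p q where pq: "f = {p, q}" "p \<noteq> q" using f by (rule edgesE)
  let ?F = "insert f H" and ?G = "insert g H"
  have FE: "?F \<subseteq> edges" and GE: "?G \<subseteq> edges" using HE f g by auto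
  note maxF = critical_imp_no_matching[OF cf] and maxG = critical_imp_no_matching[OF cg]
  have F_to_G: "matching_avoiding n ?G S" if "matching_avoiding n ?F S" "f \<inter> S \<noteq> {}" for S
    using matching_avoiding_insert_meeting[OF that] by (rule matching_avoiding_mono) auto
  have G_to_F: "matching_avoiding n ?F S" if "matching_avoiding n ?G S" "g \<inter> S \<noteq> {}" for S
    using matching_avoiding_insert_meeting[OF that] by (rule matching_avoiding_mono) auto
  have "False" if "matching_avoiding (Suc n) (insert g ?F) {}"
  proof -
    have avg: "matching_avoiding n ?F g"
      using matching_avoiding_ends_of_new_edge[OF that maxF] .
    have noG: "\<not> matching_avoiding n ?G S" if "g \<subseteq> S" for S
    proof
      assume "matching_avoiding n ?G S"
      then have "matching_avoiding n ?G g" using that by (rule_tac matching_avoiding_mono) auto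
      moreover obtain a b where "g = {a, b}" using g by (rule edgesE)
      ultimately show False using no_matching_avoiding_edge[OF maxG] by auto
    qed
    \<comment> \<open>If \<open>p\<close> were an end of \<open>g\<close>, the matching that avoids \<open>g\<close> would lie in \<open>H\<close>, hence in \<open>H + g\<close>.\<close>
    have pg: "p \<notin> g" using F_to_G[OF avg] noG pq(1) by blast
    have "matching_avoiding n ?F {p}" using cf by (simp add: critical_def)
    from matching_exchange[OF FE maxF this avg]
    consider "matching_avoiding n ?F (insert p g)"
      | x where "x \<in> g" "reachable ?F p x" "matching_avoiding n ?F (insert p (g - {x}))"
      by blast
    then show False
    proof cases
      case 1
      then have "matching_avoiding n ?G (insert p g)" by (rule F_to_G) (use pq in auto)
      then show False using noG by blast
    next
      case 2
      obtain y where y: "g = {x, y}" "x \<noteq> y" using g 2(1) by (rule edges_other_end)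
      have gal: "\<not> matching_avoiding n ?F {p, x}"
        using gallai_lemma[OF FE cf 2(2)] pg 2(1) by blast
      have py: "matching_avoiding n ?G {p, y}"
        using 2(3) y pq by (intro F_to_G) (auto simp: insert_Diff_if)
      have "matching_avoiding n ?G {x}" using cg by (simp add: critical_def)
      from matching_exchange[OF GE maxG this py]
      obtain S where S: "matching_avoiding n ?G S" "{x, p, y} \<subseteq> S \<or> {x, y} \<subseteq> S \<or> {x, p} \<subseteq> S"
        using pg y by (auto simp: insert_Diff_if)
      have "\<not> g \<subseteq> S"
      proof
        assume "g \<subseteq> S"
        with S(1) have "matching_avoiding n ?G g" by (rule matching_avoiding_mono[OF _ subset_refl])
        then show False using noG by simp
      qed
      then have "{p, x} \<subseteq> S" using S(2) y(1) by auto
      with S(1) have "matching_avoiding n ?G {p, x}" by (rule matching_avoiding_mono[OF _ subset_refl])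
      then have "matching_avoiding n ?F {p, x}" by (rule G_to_F) (use y in auto)
      then show False using gal by simp
    qed
  qed
  moreover have "matching_avoiding n (insert g ?F) {v}" for v
    using cf matching_avoiding_mono[of n ?F "{v}" "insert g ?F"] by (auto simp: critical_def)
  ultimately show ?thesis unfolding critical_def by blast
qed

section \<open>Vertices of large degree\<close>

text \<open>
  The degree bound exceeds the number \<open>2n\<close> of vertices that an \<open>n\<close>-matching covers. The
  witness \<open>A\<close> is a finite set so that being a hub is inherited by larger graphs and, for an increasing
  union of graphs, is reached at some finite stage.
\<close>

definition hub :: "nat \<Rightarrow> graph \<Rightarrow> nat \<Rightarrow> bool" where
  "hub n E b \<longleftrightarrow> (\<exists>A. finite A \<and> card A = Suc (2 * n) \<and> (\<forall>w\<in>A. {b, w} \<in> E))"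

lemma hub_mono: "hub n E b \<Longrightarrow> E \<subseteq> E' \<Longrightarrow> hub n E' b"
  unfolding hub_def by blast

text \<open>
  One of the more than \<open>2n\<close> neighbours of \<open>b\<close> is uncovered and can be matched with \<open>b\<close>.
  In particular a critical graph has no hub.
\<close>

lemma hub_augments:
  assumes E: "E \<subseteq> edges" and hub: "hub n E b" and av: "matching_avoiding n E {b}"
  shows "matching_avoiding (Suc n) E {}"
proof -
  obtain A where A: "finite A" "card A = Suc (2 * n)" "\<And>w. w \<in> A \<Longrightarrow> {b, w} \<in> E"
    using hub unfolding hub_def by blast
  obtain M where M: "M \<subseteq> E" "finite M" "card M = n" "pairwise disjnt M" "\<Union>M \<inter> {b} = {}"
    using av by (rule matching_avoidingE)
  have "card e = 2" if "e \<in> M" for e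
    using that M(1) E edgesE[of e] by (metis card_2_iff subsetD)
  then have "card (\<Union>M) \<le> 2 * n"
    using card_Union_le_sum_card[of M] M(3) by (simp add: mult.commute)
  moreover have "finite (\<Union>M)" using M(1,2) E finite_edge by blast
  ultimately have "\<not> A \<subseteq> \<Union>M" using A(2) card_mono[of "\<Union>M" A] by force
  then obtain w where w: "w \<in> A" "w \<notin> \<Union>M" by blast
  have "matching_avoiding n E ({b, w} \<union> {})"
    using M w by (intro matching_avoidingI[of M]) auto
  then have "matching_avoiding (Suc n) (insert {b, w} E) {}"
    by (rule matching_avoiding_add_edge) auto
  then show ?thesis using A(3)[OF w(1)] by (simp add: insert_absorb)
qed

text \<open>
  Without hubs all degrees are finite, so only finitely many edges meet a given finite
  matching, and it can be extended.
\<close>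

lemma infinite_matching_or_hub:
  assumes "E \<subseteq> edges" "infinite E" "\<And>b. \<not> hub n E b"
  shows "matching_avoiding m E {}"
proof (induction m)
  case 0
  show ?case unfolding matching_avoiding_def by (intro exI[of _ "{}"]) auto
next
  case (Suc m)
  then obtain M where M: "M \<subseteq> E" "finite M" "card M = m" "pairwise disjnt M" "\<Union>M \<inter> {} = {}"
    by (rule matching_avoidingE)
  have fin: "finite {w. {b, w} \<in> E}" for b
  proof (rule ccontr)
    assume "infinite {w. {b, w} \<in> E}"
    then obtain A where "A \<subseteq> {w. {b, w} \<in> E}" "finite A" "card A = Suc (2 * n)"
      using infinite_arbitrarily_large by blast
    then have "hub n E b" unfolding hub_def by blast
    then show False using assms(3) by blast
  qed
  have "finite (\<Union>M)" using M(1,2) assms(1) finite_edge by blast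
  then have "finite (\<Union>b\<in>\<Union>M. (\<lambda>w. {b, w}) ` {w. {b, w} \<in> E})" using fin by blast
  moreover have "{e \<in> E. e \<inter> \<Union>M \<noteq> {}} \<subseteq> (\<Union>b\<in>\<Union>M. (\<lambda>w. {b, w}) ` {w. {b, w} \<in> E})"
  proof
    fix e assume "e \<in> {e \<in> E. e \<inter> \<Union>M \<noteq> {}}"
    then obtain b where b: "e \<in> E" "b \<in> e" "b \<in> \<Union>M" by blast
    moreover obtain w where "e = {b, w}" using b assms(1) by (metis edges_other_end subsetD)
    ultimately show "e \<in> (\<Union>b\<in>\<Union>M. (\<lambda>w. {b, w}) ` {w. {b, w} \<in> E})" by blast
  qed
  ultimately have "finite {e \<in> E. e \<inter> \<Union>M \<noteq> {}}" by (rule rev_finite_subset)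
  then have "{e \<in> E. e \<inter> \<Union>M \<noteq> {}} \<noteq> E" using assms(2) by metis
  then obtain e where e: "e \<in> E" "e \<inter> \<Union>M = {}" by blast
  have "matching_avoiding m E (e \<union> {})"
    using M e by (intro matching_avoidingI[of M]) auto
  moreover have "e \<noteq> {}" using e assms(1) by (auto simp: edges_def)
  ultimately have "matching_avoiding (Suc m) (insert e E) {}"
    by (intro matching_avoiding_add_edge) auto
  then show ?case using e by (simp add: insert_absorb)
qed

section \<open>The edge that Seeker holds back\<close>

text \<open>
  Here \<open>H\<close> and \<open>R\<close> are the green and the red edges so far. The first two alternatives of the
  disjunction persist for the rest of the play as long as \<open>e\<close> stays white. In the third,
  \<open>e\<close> is only harmless for the moment, and an edge that would make \<open>H\<close> critical takes
  precedence over all other harmless edges. The condition that there is no hub forces Seeker to move the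
  reserve to a hub when one appears.
\<close>

definition good_reserve :: "nat \<Rightarrow> graph \<Rightarrow> graph \<Rightarrow> edge \<Rightarrow> bool" where
  "good_reserve n H R e \<longleftrightarrow> e \<in> edges - (H \<union> R) \<and>
     (matching_avoiding (Suc n) H {} \<or> (\<exists>b\<in>e. hub n H b) \<or>
      ((\<forall>b. \<not> hub n H b) \<and> \<not> matching_avoiding (Suc n) (insert e H) {} \<and>
       (critical n (insert e H) \<or> (\<forall>f\<in>edges - (H \<union> R). \<not> critical n (insert f H)))))"

lemma fresh_edge_at:
  fixes v :: nat
  assumes "finite F" obtains w where "w \<noteq> v" "{v, w} \<notin> F"
proof -
  have "inj_on (\<lambda>w. {v, w}) (UNIV - {v})" by (auto simp: inj_on_def doubleton_eq_iff)
  moreover have "infinite (UNIV - {v})" by simp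
  ultimately have "infinite ((\<lambda>w. {v, w}) ` (UNIV - {v}))" using finite_imageD by blast
  then have "\<not> (\<lambda>w. {v, w}) ` (UNIV - {v}) \<subseteq> F" using assms finite_subset by blast
  then show ?thesis using that by blast
qed

text \<open>
  In the last case of the proof no white edge makes \<open>H\<close> critical, and \<open>H\<close> is not critical because
  its \<open>n\<close>-matchings all meet some vertex \<open>v\<close>; then a white edge at \<open>v\<close> is harmless.
\<close>

lemma good_reserve_exists:
  assumes "finite H" "finite R" "H \<subseteq> edges" "\<not> critical n H"
  shows "\<exists>e. good_reserve n H R e"
proof -
  have fin: "finite (H \<union> R)" using assms by simp
  consider "matching_avoiding (Suc n) H {}" | b where "hub n H b"
    | f where "\<forall>b. \<not> hub n H b" "f \<in> edges - (H \<union> R)" "critical n (insert f H)"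
    | v where "\<not> matching_avoiding (Suc n) H {}" "\<forall>b. \<not> hub n H b"
        "\<forall>f\<in>edges - (H \<union> R). \<not> critical n (insert f H)" "\<not> matching_avoiding n H {v}"
    using assms(4) unfolding critical_def by blast
  then show ?thesis
  proof cases
    case 1
    obtain w where "w \<noteq> 0" "{0, w} \<notin> H \<union> R" using fresh_edge_at[OF fin] by metis
    then show ?thesis using 1 unfolding good_reserve_def by (intro exI[of _ "{0, w}"]) auto
  next
    case 2
    obtain w where "w \<noteq> b" "{b, w} \<notin> H \<union> R" using fresh_edge_at[OF fin] by metis
    then show ?thesis using 2 unfolding good_reserve_def by (intro exI[of _ "{b, w}"]) auto
  next
    case 3
    then show ?thesis using critical_imp_no_matching unfolding good_reserve_def by blast
  next
    case 4
    obtain w where w: "w \<noteq> v" "{v, w} \<notin> H \<union> R" using fresh_edge_at[OF fin] by metis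
    have "\<not> matching_avoiding (Suc n) (insert {v, w} H) {}"
      using matching_avoiding_ends_of_new_edge[of n "{v, w}" H] 4(1,4)
        matching_avoiding_mono[of n H "{v, w}" H "{v}"] by blast
    then show ?thesis using w 4 unfolding good_reserve_def by (intro exI[of _ "{v, w}"]) auto
  qed
qed

lemma good_reserve_red:
  "good_reserve n H R e \<Longrightarrow> f \<noteq> e \<Longrightarrow> good_reserve n H (insert f R) e"
  unfolding good_reserve_def by blast

text \<open>
  The crucial step of the strategy. If \<open>H + f\<close> is critical, then \<open>f\<close> itself was a white edge
  making \<open>H\<close> critical, so the rule of precedence had chosen an \<open>e\<close> with \<open>H + e\<close> critical. By
  \<open>critical_insert_insert\<close> this \<open>e\<close> can be kept.
\<close>

lemma good_reserve_green:
  assumes fin: "finite H" "finite R" and H: "H \<subseteq> edges"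
    and good: "good_reserve n H R e" and f: "f \<in> edges - (H \<union> R)" "f \<noteq> e"
  shows "\<exists>e'. good_reserve n (insert f H) R e'"
proof (cases "critical n (insert f H)")
  case False
  then show ?thesis using fin H f by (intro good_reserve_exists) auto
next
  case True
  have fH: "insert f H \<subseteq> edges" using f H by auto
  have nohub: "\<not> hub n (insert f H) b" for b
    using True hub_augments[OF fH] unfolding critical_def by blast
  have "\<not> matching_avoiding (Suc n) H {}"
    using critical_imp_no_matching[OF True] matching_avoiding_mono by blast
  moreover have "\<not> hub n H b" for b using nohub hub_mono by blast
  ultimately have "critical n (insert e H)" "e \<in> edges - (H \<union> R)"
    using good True f unfolding good_reserve_def by blast+
  then have "critical n (insert e (insert f H))"
    using critical_insert_insert[OF H _ _ True] f by blast
  then have "good_reserve n (insert f H) R e"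
    using \<open>e \<in> edges - (H \<union> R)\<close> f nohub critical_imp_no_matching
    unfolding good_reserve_def by blast
  then show ?thesis ..
qed

lemma good_reserve_permanent:
  assumes "good_reserve n H R e" "matching_avoiding (Suc n) H {} \<or> (\<exists>b\<in>e. hub n H b)"
    and "H \<subseteq> H'" "e \<notin> H' \<union> R'"
  shows "good_reserve n H' R' e"
  using assms matching_avoiding_mono[of "Suc n" H "{}" H'] hub_mono[of n H _ H']
  unfolding good_reserve_def by blast

lemma good_reserve_harmless:
  assumes "H \<subseteq> edges" "good_reserve n H R e" "\<not> matching_avoiding (Suc n) H {}"
  shows "\<not> matching_avoiding (Suc n) (insert e H) {}"
proof
  assume *: "matching_avoiding (Suc n) (insert e H) {}"
  then obtain b where b: "b \<in> e" "hub n H b"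
    using assms unfolding good_reserve_def by blast
  have "matching_avoiding n H e"
    using matching_avoiding_ends_of_new_edge[OF * assms(3)] .
  then have "matching_avoiding n H {b}" by (rule matching_avoiding_mono) (use b in auto)
  then show False using hub_augments[OF assms(1) b(2)] assms(3) by blast
qed

section \<open>Seeker's strategy\<close>

type_synonym position = "graph \<times> graph \<times> edge"

text \<open>
  Asking in the order of the numbering \<open>set_encode\<close> of finite sets ensures that every edge which is not
  held back forever is asked eventually.
\<close>

definition next_edge :: "position \<Rightarrow> edge" where
  "next_edge = (\<lambda>(H, R, e). arg_min set_encode (\<lambda>g. g \<in> edges - (H \<union> R) - {e}))"

text \<open>
  The reserve is changed only when it has to be. Since a good reserve stays good under red
  answers, this limits the changes to the turns at which Hider answers green.
\<close>

definition update :: "nat \<Rightarrow> position \<Rightarrow> turn \<Rightarrow> position" where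
  "update n = (\<lambda>(H, R, e) (f, c).
     let H' = (if c = Green then insert f H else H);
         R' = (if c = Red then insert f R else R)
     in (H', R', if good_reserve n H' R' e then e else (SOME e'. good_reserve n H' R' e')))"

definition start :: "nat \<Rightarrow> position" where
  "start n = ({}, {}, SOME e. good_reserve n {} {} e)"

definition reserving_strategy :: "nat \<Rightarrow> strategy" where
  "reserving_strategy n h = next_edge (foldl (update n) (start n) h)"

lemma next_edge_props:
  assumes "finite H" "finite R"
  shows "next_edge (H, R, e) \<in> edges - (H \<union> R) - {e}"
    and "g \<in> edges - (H \<union> R) - {e} \<Longrightarrow> set_encode (next_edge (H, R, e)) \<le> set_encode g"
proof -
  obtain w where "w \<noteq> 0" "{0, w} \<notin> H \<union> R \<union> {e}"
    using fresh_edge_at[of "H \<union> R \<union> {e}"] assms by (metis finite.intros finite_UnI)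
  then have "{0, w} \<in> edges - (H \<union> R) - {e}" by auto
  then show "next_edge (H, R, e) \<in> edges - (H \<union> R) - {e}"
    unfolding next_edge_def
    using arg_min_natI[of "\<lambda>g. g \<in> edges - (H \<union> R) - {e}" "{0, w}" set_encode] by simp
  show "g \<in> edges - (H \<union> R) - {e} \<Longrightarrow> set_encode (next_edge (H, R, e)) \<le> set_encode g"
    unfolding next_edge_def
    using arg_min_nat_le[of "\<lambda>g. g \<in> edges - (H \<union> R) - {e}" g set_encode] by simp
qed

locale reserving_play =
  fixes n :: nat and p :: play
  assumes n_pos: "0 < n" and follows: "follows (reserving_strategy n) p"
begin

definition position_at :: "nat \<Rightarrow> position" where
  "position_at i = foldl (update n) (start n) (map p [0..<i])"

definition greens :: "nat \<Rightarrow> graph" where "greens i = fst (position_at i)"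
definition reds :: "nat \<Rightarrow> graph" where "reds i = fst (snd (position_at i))"
definition reserve :: "nat \<Rightarrow> edge" where "reserve i = snd (snd (position_at i))"

lemma position_at_eq: "position_at i = (greens i, reds i, reserve i)"
  by (simp add: greens_def reds_def reserve_def)

lemma asked: "fst (p i) = next_edge (greens i, reds i, reserve i)"
  using follows position_at_eq[of i]
  by (simp add: follows_def reserving_strategy_def position_at_def)

lemma position_at_Suc: "position_at (Suc i) = update n (position_at i) (p i)"
  by (simp add: position_at_def)

lemma greens_Suc: "greens (Suc i) = (if snd (p i) = Green then insert (fst (p i)) (greens i) else greens i)"
  and reds_Suc: "reds (Suc i) = (if snd (p i) = Red then insert (fst (p i)) (reds i) else reds i)"
  and reserve_Suc: "reserve (Suc i) =
    (if good_reserve n (greens (Suc i)) (reds (Suc i)) (reserve i) then reserve i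
     else (SOME e. good_reserve n (greens (Suc i)) (reds (Suc i)) e))"
  using position_at_Suc[of i] unfolding position_at_eq
  by (cases "p i"; auto simp: update_def Let_def)+

lemma greens_eq: "greens i = {e. \<exists>j<i. p j = (e, Green)}"
proof (induction i)
  case 0
  show ?case by (simp add: greens_def position_at_def start_def)
next
  case (Suc i)
  then show ?case by (cases "p i") (auto simp: greens_Suc less_Suc_eq)
qed

lemma reds_eq: "reds i = {e. \<exists>j<i. p j = (e, Red)}"
proof (induction i)
  case 0
  show ?case by (simp add: reds_def position_at_def start_def)
next
  case (Suc i)
  then show ?case by (cases "p i") (auto simp: reds_Suc less_Suc_eq)
qed

lemma greens_reds: "greens i \<union> reds i = (\<lambda>j. fst (p j)) ` {..<i}"
proof -
  have "fst (p j) \<in> greens i \<union> reds i" if "j < i" for j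
    using that by (cases "p j"; cases "snd (p j)") (auto simp: greens_eq reds_eq)
  then show ?thesis by (force simp: greens_eq reds_eq)
qed

lemma finite_greens: "finite (greens i)" and finite_reds: "finite (reds i)"
  using greens_reds[of i] by (metis finite_Un finite_imageI finite_lessThan)+

lemma asked_new: "fst (p i) \<in> edges - (greens i \<union> reds i) - {reserve i}"
  unfolding asked by (rule next_edge_props(1)[OF finite_greens finite_reds])

lemma legal: "legal p"
  unfolding legal_def
proof (intro allI conjI impI)
  fix i show "fst (p i) \<in> edges" using asked_new[of i] by blast
  fix j assume "j < i"
  then have "fst (p j) \<in> greens i \<union> reds i" unfolding greens_reds by (intro imageI) simp
  moreover have "fst (p i) \<notin> greens i \<union> reds i" using asked_new[of i] by blast
  ultimately show "fst (p i) \<noteq> fst (p j)" by metis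
qed

lemma greens_edges: "greens i \<subseteq> edges"
proof -
  have "greens i \<subseteq> (\<lambda>j. fst (p j)) ` {..<i}" using greens_reds[of i] by blast
  then show ?thesis using asked_new by auto
qed

lemma greens_mono: "i \<le> j \<Longrightarrow> greens i \<subseteq> greens j"
  by (auto simp: greens_eq intro: less_le_trans)

lemma good: "good_reserve n (greens i) (reds i) (reserve i)"
proof (induction i)
  case 0
  have "\<not> critical n {}"
    using n_pos by (auto simp: critical_def matching_avoiding_def)
  then have "\<exists>e. good_reserve n {} {} e" by (intro good_reserve_exists) auto
  then have "good_reserve n {} {} (SOME e. good_reserve n {} {} e)" by (rule someI_ex)
  then show ?case by (simp add: greens_def reds_def reserve_def position_at_def start_def)
next
  case (Suc i)
  have "\<exists>e. good_reserve n (greens (Suc i)) (reds (Suc i)) e"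
  proof (cases "snd (p i)")
    case Red
    then show ?thesis using good_reserve_red[OF Suc] asked_new[of i]
      by (auto simp: greens_Suc reds_Suc)
  next
    case Green
    then show ?thesis
      using good_reserve_green[OF finite_greens finite_reds greens_edges Suc] asked_new[of i]
      by (auto simp: greens_Suc reds_Suc)
  qed
  then show ?case unfolding reserve_Suc by (simp add: someI_ex)
qed

lemma reserve_white_after: "reserve i \<in> edges - (greens (Suc i) \<union> reds (Suc i))"
  using good[of i] asked_new[of i] unfolding good_reserve_def
  by (auto simp: greens_Suc reds_Suc)

lemma reserve_stable_red:
  assumes "greens (Suc i) = greens i"
  shows "reserve (Suc i) = reserve i"
proof -
  have "snd (p i) = Red"
    using assms asked_new[of i] by (cases "snd (p i)") (auto simp: greens_Suc)
  then show ?thesis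
    using good_reserve_red[OF good[of i]] asked_new[of i] by (auto simp: reserve_Suc greens_Suc reds_Suc)
qed

text \<open>The situations in which the reserve is never changed again.\<close>

definition settled :: "nat \<Rightarrow> bool" where
  "settled i \<longleftrightarrow> matching_avoiding (Suc n) (greens i) {} \<or> (\<exists>b\<in>reserve i. hub n (greens i) b)"

lemma settled_stable:
  assumes "settled i" shows "reserve (Suc i) = reserve i" "settled (Suc i)"
proof -
  have sub: "greens i \<subseteq> greens (Suc i)" by (rule greens_mono) simp
  show eq: "reserve (Suc i) = reserve i"
    using good_reserve_permanent[OF good[of i] _ sub, of "reds (Suc i)"] assms reserve_white_after[of i]
    unfolding settled_def by (simp add: reserve_Suc)
  show "settled (Suc i)"
    using assms matching_avoiding_mono[OF _ sub, of "Suc n" "{}" "{}"] hub_mono[OF _ sub, of n]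
    unfolding settled_def eq by blast
qed

lemma greens_Union: "(\<Union>i. greens i) = green_edges p"
  by (auto simp: greens_eq green_edges_def)

lemma finite_subset_greens:
  assumes "finite A" "A \<subseteq> green_edges p" obtains i where "A \<subseteq> greens i"
proof -
  have "\<exists>i. A \<subseteq> greens i" using assms
  proof (induction A rule: finite_induct)
    case empty
    show ?case by simp
  next
    case (insert a A)
    then obtain i j where "A \<subseteq> greens i" "a \<in> greens j" unfolding greens_Union[symmetric] by blast
    then have "insert a A \<subseteq> greens (max i j)"
      using greens_mono[of i "max i j"] greens_mono[of j "max i j"] by auto
    then show ?case by blast
  qed
  then show ?thesis using that by blast
qed

text \<open>
  If the play is never settled, then no hub and no \<open>(n+1)\<close>-matching appears among the green
  edges at any stage, hence none in their union. So only finitely many edges turn green, and after the last of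
  them the reserve is fixed.
\<close>

lemma reserve_eventually_constant: "\<exists>T. \<forall>i\<ge>T. reserve i = reserve T"
proof (cases "\<exists>T. settled T")
  case True
  then obtain T where "settled T" ..
  have "settled i \<and> reserve i = reserve T" if "i \<ge> T" for i
    using that by (induction rule: dec_induct) (simp_all add: settled_stable \<open>settled T\<close>)
  then show ?thesis by blast
next
  case False
  have nohub: "\<not> hub n (greens i) b" and nomatch: "\<not> matching_avoiding (Suc n) (greens i) {}" for i b
    using False good[of i] unfolding settled_def good_reserve_def by blast+
  \<comment> \<open>Hubs and matchings of the final green graph have finite witnesses, so they show at a finite stage.\<close>
  have "\<not> hub n (green_edges p) b" for b
  proof
    assume "hub n (green_edges p) b"
    then obtain A where A: "finite A" "card A = Suc (2 * n)" "\<forall>w\<in>A. {b, w} \<in> green_edges p"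
      unfolding hub_def by blast
    then obtain i where "(\<lambda>w. {b, w}) ` A \<subseteq> greens i"
      using finite_subset_greens[of "(\<lambda>w. {b, w}) ` A"] by blast
    then have "hub n (greens i) b" using A unfolding hub_def by blast
    then show False using nohub by blast
  qed
  moreover have "\<not> matching_avoiding (Suc n) (green_edges p) {}"
  proof
    assume "matching_avoiding (Suc n) (green_edges p) {}"
    then obtain M where M: "M \<subseteq> green_edges p" "finite M" "card M = Suc n" "pairwise disjnt M" "\<Union>M \<inter> {} = {}"
      by (rule matching_avoidingE)
    then obtain i where "M \<subseteq> greens i" using finite_subset_greens by blast
    then show False using nomatch M matching_avoidingI[of M "greens i" "Suc n" "{}"] by auto
  qed
  moreover have "green_edges p \<subseteq> edges" using greens_edges greens_Union by blast
  ultimately have "finite (green_edges p)" using infinite_matching_or_hub by blast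
  then obtain T where T: "green_edges p \<subseteq> greens T" using finite_subset_greens by blast
  have const: "greens i = greens T" if "i \<ge> T" for i
    using T greens_mono[OF that] greens_Union by blast
  have "reserve i = reserve T" if "i \<ge> T" for i
    using that
  proof (induction rule: dec_induct)
    case (step m)
    then show ?case using reserve_stable_red[of m] const[of m] const[of "Suc m"] by simp
  qed simp
  then show ?thesis by blast
qed

lemma green_or_red: "green_edges p \<union> red_edges p = range (\<lambda>j. fst (p j))"
proof -
  have "fst (p j) \<in> green_edges p \<union> red_edges p" for j
    by (cases "p j"; cases "snd (p j)") (auto simp: green_edges_def red_edges_def)
  moreover have "green_edges p \<union> red_edges p \<subseteq> range (\<lambda>j. fst (p j))"
  proof
    fix e assume "e \<in> green_edges p \<union> red_edges p"
    then obtain j c where "p j = (e, c)" unfolding green_edges_def red_edges_def by blast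
    then show "e \<in> range (\<lambda>j. fst (p j))" using rangeI[of "\<lambda>j. fst (p j)" j] by simp
  qed
  ultimately show ?thesis by blast
qed

text \<open>
  An edge \<open>g \<noteq> r\<close> that is never asked would be a candidate at every late turn. All edges asked from
  then on would have at most the number of \<open>g\<close>, but they are pairwise distinct.
\<close>

lemma white_edges_eq:
  assumes T: "\<forall>i\<ge>T. reserve i = r"
  shows "white_edges p = {r}"
proof -
  have r_white: "r \<in> edges" "r \<noteq> fst (p j)" for j
  proof -
    have "r = reserve (max T (Suc j))" using T by simp
    then have "r \<in> edges - (greens (max T (Suc j)) \<union> reds (max T (Suc j)))"
      using good[of "max T (Suc j)"] unfolding good_reserve_def by simp
    then show "r \<in> edges" "r \<noteq> fst (p j)" unfolding greens_reds by auto
  qed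
  have asked: "g \<in> range (\<lambda>j. fst (p j))" if g: "g \<in> edges" "g \<noteq> r" for g
  proof (rule ccontr)
    assume never: "g \<notin> range (\<lambda>j. fst (p j))"
    have "set_encode (fst (p i)) \<le> set_encode g" if "i \<ge> T" for i
    proof -
      have "g \<in> edges - (greens i \<union> reds i) - {reserve i}"
        using g never T that unfolding greens_reds by auto
      then show ?thesis unfolding asked by (rule next_edge_props(2)[OF finite_greens finite_reds])
    qed
    then have "(\<lambda>i. set_encode (fst (p i))) ` {T..} \<subseteq> {..set_encode g}" by auto
    moreover have "inj_on (\<lambda>i. set_encode (fst (p i))) {T..}"
    proof (rule inj_onI)
      fix i j assume "set_encode (fst (p i)) = set_encode (fst (p j))"
      moreover have "finite (fst (p i))" "finite (fst (p j))"
        using asked_new finite_edge by blast+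
      ultimately have "fst (p i) = fst (p j)" using set_encode_eq by blast
      then show "i = j" using legal unfolding legal_def by (metis linorder_neqE_nat)
    qed
    ultimately have "finite {T..}" using inj_on_finite by blast
    then show False using infinite_Ici by blast
  qed
  have "white_edges p = edges - range (\<lambda>j. fst (p j))"
    unfolding white_edges_def using green_or_red by (simp add: Un_commute)
  also have "\<dots> = {r}" using asked r_white by auto
  finally show ?thesis .
qed

lemma seeker_wins: "seeker_wins (contains_independent_edges (Suc n)) p"
proof -
  obtain T r where T: "\<forall>i\<ge>T. reserve i = r" using reserve_eventually_constant by blast
  note white = white_edges_eq[OF T]
  show ?thesis
  proof (cases "\<exists>i. matching_avoiding (Suc n) (greens i) {}")
    case True
    then obtain i where i: "matching_avoiding (Suc n) (greens i) {}" ..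
    have sub: "greens i \<subseteq> green_edges p" using greens_Union by blast
    have "possible_graphs p \<subseteq> contains_independent_edges (Suc n)"
    proof
      fix G assume G: "G \<in> possible_graphs p"
      then have "greens i \<subseteq> G" using sub unfolding possible_graphs_def by blast
      with i have "matching_avoiding (Suc n) G {}" by (rule matching_avoiding_mono) simp
      then show "G \<in> contains_independent_edges (Suc n)"
        using G unfolding possible_graphs_def contains_independent_edges_iff by blast
    qed
    then show ?thesis using white unfolding seeker_wins_def by simp
  next
    case False
    have "G \<notin> contains_independent_edges (Suc n)" if G: "G \<in> possible_graphs p" for G
    proof
      assume "G \<in> contains_independent_edges (Suc n)"
      then have "matching_avoiding (Suc n) G {}" by (simp add: contains_independent_edges_iff)
      then obtain M where M: "M \<subseteq> G" "finite M" "card M = Suc n" "pairwise disjnt M"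
        "\<Union>M \<inter> {} = {}"
        by (rule matching_avoidingE)
      have "M - {r} \<subseteq> green_edges p" using M(1) G white unfolding possible_graphs_def by blast
      then obtain i where i: "M - {r} \<subseteq> greens i"
        using finite_subset_greens[of "M - {r}"] M(2) by blast
      let ?i = "max i T"
      have "M \<subseteq> insert (reserve ?i) (greens ?i)"
        using i greens_mono[of i ?i] T by auto
      then have "matching_avoiding (Suc n) (insert (reserve ?i) (greens ?i)) {}"
        using M by (intro matching_avoidingI[of M]) auto
      then show False
        using good_reserve_harmless[OF greens_edges good[of ?i]] False by blast
    qed
    then have "possible_graphs p \<subseteq> Pow edges - contains_independent_edges (Suc n)"
      unfolding possible_graphs_def by blast
    then show ?thesis using white unfolding seeker_wins_def by simp
  qed
qed

end

theorem theorem4p1: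
  fixes k :: nat
  assumes "2 \<le> k"
  shows "\<not> infinity_elusive (contains_independent_edges k)"
proof -
  obtain n where k: "k = Suc n" and "0 < n"
    using assms by (cases k) auto
  have "winning_strategy (contains_independent_edges k) (reserving_strategy n)"
    unfolding winning_strategy_def
  proof (intro allI impI)
    fix p assume "follows (reserving_strategy n) p"
    then interpret reserving_play n p
      using \<open>0 < n\<close> by unfold_locales
    show "legal p \<and> seeker_wins (contains_independent_edges k) p"
      using legal seeker_wins k by simp
  qed
  then show ?thesis unfolding infinity_elusive_def by blast
qed

end
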